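(* For every fixed graph $H$ with at least two edges, the lower threshold of the Avoider--Enforcer $H$-game satisfies $$f^-_H(n)=O\big(n^{1/m(H)}\big)\qquad (n\to\infty).$$
   Context: All graphs are finite and simple; $H$ is fixed and $n\to\infty$, and the implied constant may depend on $H$. Let $H$ be a graph with at least two edges and let $n,b$ be positive integers. In the $(1:b)$ (strict) Avoider--Enforcer $H$-game on $K_n$, two players, Avoider and Enforcer, alternately claim previously unclaimed edges of $K_n$, Avoider moving first. Avoider claims exactly one edge per turn and Enforcer claims exactly $b$ edges per turn; if strictly fewer than $b$ edges are unclaimed before a move of Enforcer, he claims all of them. The game ends when all edges are claimed. Avoider loses (Enforcer wins) if the graph of Avoider's edges then contains a copy of $H$; otherwise Avoider wins. The lower threshold $f^-_H(n)$ is the largest integer such that for every $b\le f^-_H(n)$ Enforcer has a winning strategy in the $(1:b)$ $H$-game on $K_n$. $m(H)=\max_{F\subseteq H,\ v(F)\ge 1} e(F)/v(F)$, where $v(F)$ and $e(F)$ are the numbers of vertices and edges of $F$. *)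

theory Defs
  imports Complex_Main "HOL-Library.Landau_Symbols"
begin

record 'a graph =
  verts :: "'a set"
  edges :: "'a set set"

definition simple_graph :: "'a graph \<Rightarrow> bool" where
  "simple_graph G \<longleftrightarrow> finite (verts G) \<and> (\<forall>e\<in>edges G. e \<subseteq> verts G \<and> card e = 2)"

definition subgraph :: "'a graph \<Rightarrow> 'a graph \<Rightarrow> bool" where
  "subgraph F G \<longleftrightarrow> simple_graph F \<and> verts F \<subseteq> verts G \<and> edges F \<subseteq> edges G"

definition max_density :: "'a graph \<Rightarrow> real" where
  "max_density H =
     Max {real (card (edges F)) / real (card (verts F)) |F. subgraph F H \<and> verts F \<noteq> {}}"

text \<open>Copies are subgraphs, not necessarily induced.\<close>

definition contains_copy :: "'b graph \<Rightarrow> 'a graph \<Rightarrow> bool" where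
  "contains_copy G H \<longleftrightarrow>
     (\<exists>\<phi>. inj_on \<phi> (verts H) \<and> \<phi> ` verts H \<subseteq> verts G \<and> (\<forall>e\<in>edges H. \<phi> ` e \<in> edges G))"

definition complete_graph :: "nat \<Rightarrow> nat graph" where
  "complete_graph n = \<lparr>verts = {..<n}, edges = {e. e \<subseteq> {..<n} \<and> card e = 2}\<rparr>"

text \<open>
  A history is the list of the sets of board elements claimed in the moves made so far, in
  chronological order; Avoider made the moves at the even positions (starting from 0) and Enforcer
  those at the odd positions.
\<close>

definition unclaimed :: "'e set \<Rightarrow> 'e set list \<Rightarrow> 'e set" where
  "unclaimed X ms = X - \<Union>(set ms)"

definition legal_move :: "'e set \<Rightarrow> nat \<Rightarrow> 'e set list \<Rightarrow> 'e set \<Rightarrow> bool" where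
  "legal_move X b ms M \<longleftrightarrow>
     M \<subseteq> unclaimed X ms \<and>
     card M = (if even (length ms) then 1 else min b (card (unclaimed X ms)))"

inductive play :: "'e set \<Rightarrow> nat \<Rightarrow> 'e set list \<Rightarrow> bool" for X :: "'e set" and b :: nat where
  start: "play X b []"
| move: "play X b (ms @ [M])"
    if "play X b ms" and "unclaimed X ms \<noteq> {}" and "legal_move X b ms M"

definition finished :: "'e set \<Rightarrow> 'e set list \<Rightarrow> bool" where
  "finished X ms \<longleftrightarrow> unclaimed X ms = {}"

definition avoider_edges :: "'e set list \<Rightarrow> 'e set" where
  "avoider_edges ms = \<Union>{ms ! i |i. i < length ms \<and> even i}"

text \<open>An Enforcer strategy maps every history in which he is to move to the set he claims.\<close>

definition follows :: "('e set list \<Rightarrow> 'e set) \<Rightarrow> 'e set list \<Rightarrow> bool" where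
  "follows \<sigma> ms \<longleftrightarrow> (\<forall>i<length ms. odd i \<longrightarrow> ms ! i = \<sigma> (take i ms))"

definition enforcer_strategy :: "'e set \<Rightarrow> nat \<Rightarrow> ('e set list \<Rightarrow> 'e set) \<Rightarrow> bool" where
  "enforcer_strategy X b \<sigma> \<longleftrightarrow>
     (\<forall>ms. play X b ms \<and> follows \<sigma> ms \<and> odd (length ms) \<and> \<not> finished X ms \<longrightarrow>
        legal_move X b ms (\<sigma> ms))"

definition enforcer_wins :: "'a graph \<Rightarrow> nat \<Rightarrow> nat \<Rightarrow> bool" where
  "enforcer_wins H n b \<longleftrightarrow>
     (\<exists>\<sigma>. enforcer_strategy (edges (complete_graph n)) b \<sigma> \<and>
        (\<forall>ms. play (edges (complete_graph n)) b ms \<and> follows \<sigma> ms \<and>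
            finished (edges (complete_graph n)) ms \<longrightarrow>
          contains_copy \<lparr>verts = verts (complete_graph n), edges = avoider_edges ms\<rparr> H))"

text \<open>
  The largest such integer is nonnegative, because the condition on the positive biases
  \<open>b \<le> k\<close> is vacuous for \<open>k = 0\<close>; it exists by \<open>lower_threshold_greatest\<close> below.
\<close>

definition lower_threshold :: "'a graph \<Rightarrow> nat \<Rightarrow> nat" where
  "lower_threshold H n = (GREATEST k. \<forall>b. 1 \<le> b \<and> b \<le> k \<longrightarrow> enforcer_wins H n b)"

lemma contains_copy_card_edges:
  assumes "simple_graph H" and "contains_copy G H" and "finite (edges G)"
  shows "card (edges H) \<le> card (edges G)"
proof -
  obtain \<phi> where \<phi>: "inj_on \<phi> (verts H)" "\<forall>e\<in>edges H. \<phi> ` e \<in> edges G"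
    using assms(2) unfolding contains_copy_def by blast
  have "inj_on ((`) \<phi>) (edges H)"
    using \<phi>(1) assms(1) unfolding simple_graph_def inj_on_def[of "(`) \<phi>"]
    by (metis inj_on_image_eq_iff)
  moreover have "(`) \<phi> ` edges H \<subseteq> edges G" using \<phi>(2) by blast
  ultimately show ?thesis using assms(3) by (metis card_inj_on_le)
qed

lemma enforcer_wins_bias_less:
  assumes H: "simple_graph H" "2 \<le> card (edges H)" and win: "enforcer_wins H n b"
  shows "b < card (edges (complete_graph n))"
proof (rule ccontr)
  assume "\<not> ?thesis"
  then have b: "card (edges (complete_graph n)) \<le> b" by simp
  define X where "X = edges (complete_graph n)"
  have fin: "finite X" unfolding X_def complete_graph_def
    by (auto intro: finite_subset[of _ "Pow {..<n}"])
  obtain \<sigma> where str: "enforcer_strategy X b \<sigma>"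
    and cp: "\<And>ms. play X b ms \<Longrightarrow> follows \<sigma> ms \<Longrightarrow> finished X ms \<Longrightarrow>
      contains_copy \<lparr>verts = verts (complete_graph n), edges = avoider_edges ms\<rparr> H"
    using win unfolding enforcer_wins_def X_def by blast
  have no: False if "play X b ms" "follows \<sigma> ms" "finished X ms"
    "finite (avoider_edges ms)" "card (avoider_edges ms) \<le> 1" for ms
    using contains_copy_card_edges[OF H(1) cp[OF that(1-3)]] that(4,5) H(2) by simp
  show False
  proof (cases "X = {}")
    case True
    show False
      by (rule no[of "[]"])
        (auto simp: play.start follows_def finished_def unclaimed_def avoider_edges_def True)
  next
    case False
    then obtain e where e: "e \<in> X" by blast
    have p1: "play X b [{e}]"
      using play.move[OF play.start, of X b "{e}"] e by (auto simp: unclaimed_def legal_move_def)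
    have f1: "follows \<sigma> [{e}]" by (simp add: follows_def)
    have a1: "avoider_edges [{e}] = {e}" by (auto simp: avoider_edges_def)
    have nf: "\<not> finished X [{e}]" using no[OF p1 f1] a1 by auto
    have l2: "legal_move X b [{e}] (\<sigma> [{e}])"
      using str p1 f1 nf unfolding enforcer_strategy_def by simp
    have p2: "play X b ([{e}] @ [\<sigma> [{e}]])"
      using play.move[OF p1 _ l2] nf by (simp add: finished_def)
    have "card (unclaimed X [{e}]) \<le> b"
      using b card_mono[OF fin, of "unclaimed X [{e}]"] by (auto simp: unclaimed_def X_def)
    then have "\<sigma> [{e}] = unclaimed X [{e}]"
      using l2 fin by (intro card_subset_eq) (auto simp: legal_move_def unclaimed_def)
    then have fn2: "finished X ([{e}] @ [\<sigma> [{e}]])"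
      by (auto simp: finished_def unclaimed_def)
    have a2: "avoider_edges ([{e}] @ [\<sigma> [{e}]]) = {e}"
      by (auto simp: avoider_edges_def less_Suc_eq)
    have f2: "follows \<sigma> ([{e}] @ [\<sigma> [{e}]])" by (auto simp: follows_def less_Suc_eq)
    show False using no[OF p2 f2 fn2] a2 by simp
  qed
qed

lemma lower_threshold_greatest:
  assumes "simple_graph H" and "2 \<le> card (edges H)"
  shows "\<forall>b. 1 \<le> b \<and> b \<le> lower_threshold H n \<longrightarrow> enforcer_wins H n b"
    and "(\<forall>b. 1 \<le> b \<and> b \<le> k \<longrightarrow> enforcer_wins H n b) \<Longrightarrow> k \<le> lower_threshold H n"
proof -
  let ?P = "\<lambda>k. \<forall>b. 1 \<le> b \<and> b \<le> k \<longrightarrow> enforcer_wins H n b"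
  have bd: "k \<le> card (edges (complete_graph n))" if "?P k" for k
    using that enforcer_wins_bias_less[OF assms, of n k] by (cases k) auto
  show "?P (lower_threshold H n)" unfolding lower_threshold_def
    by (rule GreatestI_nat[of ?P 0, OF _ bd]) auto
  show "?P k \<Longrightarrow> k \<le> lower_threshold H n" unfolding lower_threshold_def
    by (rule Greatest_le_nat[of ?P, OF _ bd])
qed

end

theory Submission
  imports Defs "HOL-Library.FuncSet"
begin

text \<open>
  It suffices to exhibit a single bias of order \<open>n powr (1 / m(H))\<close> at which Avoider wins. Let \<open>F\<close> be a
  subgraph of \<open>H\<close> of maximal density, with \<open>v\<close> vertices and \<open>k\<close> edges. Avoider weights each copy of
  \<open>F\<close> not yet hit by Enforcer by \<open>c\<close> to the power minus the number of its unclaimed edges, where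
  \<open>c = 1 + b / k\<close>, and always takes an edge of minimal weight. In a full round the \<open>b\<close> edges claimed by
  Enforcer destroy at least the weight that Avoider's edge has created, so the total weight never
  exceeds its initial value, which is at most \<open>n ^ v * (k / b) ^ k\<close>. In an incomplete last round
  with \<open>r\<close> free edges Avoider's move multiplies the total weight by at most \<open>1 + b / r\<close>. This is
  harmless if \<open>r\<close>, the remainder of the number \<open>N\<close> of edges modulo \<open>b + 1\<close>, is at least a constant
  fraction of \<open>b + 1\<close>. Such a bias exists in every interval \<open>[A, 3 A]\<close> of the relevant order: otherwise
  \<open>N / a\<close> would be close to an integer for all \<open>a\<close> in the interval, hence so would its iterated
  differences, but one of these moves slowly while dropping to at most half its value.
\<close>

section \<open>The weight function\<close>

text \<open>Enforcer's edges enter only through the condition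
  \<open>D \<subseteq> A \<union> U\<close>. Once \<open>U\<close> is empty every surviving member
  contributes 1, so a value below 1 certifies that no member lies in \<open>A\<close>.\<close>

definition danger :: "real \<Rightarrow> 'e set set \<Rightarrow> 'e set \<Rightarrow> 'e set \<Rightarrow> real" where
  "danger c \<F> A U = (\<Sum>D | D \<in> \<F> \<and> D \<subseteq> A \<union> U. (1 / c) ^ card (D \<inter> U))"

definition edge_danger :: "real \<Rightarrow> 'e set set \<Rightarrow> 'e set \<Rightarrow> 'e set \<Rightarrow> 'e \<Rightarrow> real" where
  "edge_danger c \<F> A U e = (\<Sum>D | D \<in> \<F> \<and> D \<subseteq> A \<union> U \<and> e \<in> D. (1 / c) ^ card (D \<inter> U))"

lemma danger_nonneg: "0 < c \<Longrightarrow> 0 \<le> danger c \<F> A U"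
  unfolding danger_def by (intro sum_nonneg) auto

lemma power_card_remove:
  assumes "0 < (c::real)" "e \<in> D" "e \<in> U" "finite U"
  shows "(1 / c) ^ card (D \<inter> (U - {e})) = c * (1 / c) ^ card (D \<inter> U)"
proof -
  have "D \<inter> U = insert e (D \<inter> (U - {e}))" using assms by auto
  then have "card (D \<inter> U) = Suc (card (D \<inter> (U - {e})))"
    using assms(4) by (metis Diff_iff IntD2 card_insert_disjoint finite_Diff finite_Int insertI1)
  then show ?thesis using assms(1) by simp
qed

text \<open>The union of Avoider's and the free edges is unchanged, so the same members stay alive;
  those through \<open>e\<close> lose one free edge and gain a factor \<open>c\<close>.\<close>

lemma danger_avoider_move:
  assumes "finite \<F>" "finite U" "0 < c" "e \<in> U"
  shows "danger c \<F> (insert e A) (U - {e}) = danger c \<F> A U + (c - 1) * edge_danger c \<F> A U e"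
proof -
  have alive: "insert e A \<union> (U - {e}) = A \<union> U" using assms(4) by auto
  let ?S = "{D \<in> \<F>. D \<subseteq> A \<union> U}"
  have eq: "(1 / c) ^ card (D \<inter> (U - {e})) =
      (1 / c) ^ card (D \<inter> U) + (c - 1) * (if e \<in> D then (1 / c) ^ card (D \<inter> U) else 0)" for D
  proof (cases "e \<in> D")
    case True
    then show ?thesis using power_card_remove[OF assms(3) True assms(4,2)]
      by (simp add: algebra_simps)
  next
    case False
    then have "D \<inter> (U - {e}) = D \<inter> U" by auto
    with False show ?thesis by simp
  qed
  have "{D \<in> \<F>. D \<subseteq> A \<union> U \<and> e \<in> D} = {D \<in> ?S. e \<in> D}" by auto
  then have "edge_danger c \<F> A U e = (\<Sum>D\<in>?S. if e \<in> D then (1 / c) ^ card (D \<inter> U) else 0)"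
    unfolding edge_danger_def using assms(1) by (simp only:) (rule sum.inter_filter, simp)
  then show ?thesis
    unfolding danger_def alive eq sum.distrib sum_distrib_left[symmetric] by simp
qed

lemma edge_danger_avoider_move:
  assumes "finite \<F>" "finite U" "1 \<le> c" "e \<in> U"
  shows "edge_danger c \<F> A U f \<le> edge_danger c \<F> (insert e A) (U - {e}) f"
proof -
  have alive: "insert e A \<union> (U - {e}) = A \<union> U" using assms(4) by auto
  show ?thesis
    unfolding edge_danger_def alive
    using assms by (intro sum_mono power_decreasing card_mono) auto
qed

text \<open>Double counting: a member hit by \<open>M\<close> is counted at most \<open>k\<close>
  times on the left, and the difference on the right is the total weight of exactly the members
  hit.\<close>

lemma sum_edge_danger_le:
  assumes "finite \<F>" "finite U" "0 < c" "M \<subseteq> U" and k: "\<And>D. D \<in> \<F> \<Longrightarrow> finite D \<and> card D \<le> k"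
    and "A \<inter> U = {}"
  shows "(\<Sum>f\<in>M. edge_danger c \<F> A U f) \<le> real k * (danger c \<F> A U - danger c \<F> A (U - M))"
proof -
  let ?S = "{D \<in> \<F>. D \<subseteq> A \<union> U}"
  let ?w = "\<lambda>D. (1 / c) ^ card (D \<inter> U)"
  have finS: "finite ?S" using assms(1) by simp
  have finM: "finite M" using assms(2,4) finite_subset by blast
  have S: "{D \<in> \<F>. D \<subseteq> A \<union> U \<and> f \<in> D} = {D \<in> ?S. f \<in> D}" for f by auto
  have "(\<Sum>f\<in>M. edge_danger c \<F> A U f) = (\<Sum>f\<in>M. \<Sum>D\<in>?S. if f \<in> D then ?w D else 0)"
    unfolding edge_danger_def S using assms(1) by (intro sum.cong refl sum.inter_filter) simp
  also have "\<dots> = (\<Sum>D\<in>?S. \<Sum>f\<in>M. if f \<in> D then ?w D else 0)" by (rule sum.swap)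
  also have "\<dots> = (\<Sum>D\<in>?S. real (card (D \<inter> M)) * ?w D)"
  proof (intro sum.cong refl)
    fix D
    have "{f \<in> M. f \<in> D} = D \<inter> M" by auto
    then show "(\<Sum>f\<in>M. if f \<in> D then ?w D else 0) = real (card (D \<inter> M)) * ?w D"
      using sum.inter_filter[OF finM, of "\<lambda>_. ?w D" "\<lambda>f. f \<in> D"] by simp
  qed
  also have "\<dots> \<le> (\<Sum>D\<in>?S. if D \<inter> M = {} then 0 else real k * ?w D)"
  proof (intro sum_mono)
    fix D assume D: "D \<in> ?S"
    then have "card (D \<inter> M) \<le> k"
      using k[of D] card_mono[OF _ Int_lower1, of D M] by simp
    then show "real (card (D \<inter> M)) * ?w D \<le> (if D \<inter> M = {} then 0 else real k * ?w D)"
      using assms(3) by (auto intro!: mult_right_mono)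
  qed
  also have "\<dots> = (\<Sum>D\<in>?S. real k * ?w D - (if D \<inter> M = {} then real k * ?w D else 0))"
    by (intro sum.cong) auto
  also have "\<dots> = real k * danger c \<F> A U - (\<Sum>D\<in>{D \<in> ?S. D \<inter> M = {}}. real k * ?w D)"
    using sum.inter_filter[OF finS, of "\<lambda>D. real k * ?w D" "\<lambda>D. D \<inter> M = {}"]
    by (simp only: sum_subtractf danger_def sum_distrib_left)
  also have "(\<Sum>D\<in>{D \<in> ?S. D \<inter> M = {}}. real k * ?w D) = real k * danger c \<F> A (U - M)"
  proof -
    have "{D \<in> ?S. D \<inter> M = {}} = {D \<in> \<F>. D \<subseteq> A \<union> (U - M)}" using assms(4,6) by blast
    moreover have "D \<inter> (U - M) = D \<inter> U" if "D \<subseteq> A \<union> (U - M)" for D using that assms(4,6) by blast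
    ultimately show ?thesis unfolding danger_def sum_distrib_left by (intro sum.cong) auto
  qed
  finally show ?thesis by (simp add: algebra_simps)
qed

lemma danger_ge_1:
  assumes "finite \<F>" "0 < c" "D \<in> \<F>" "D \<subseteq> A"
  shows "1 \<le> danger c \<F> A {}"
proof -
  have "(\<Sum>D\<in>{D}. 1::real) \<le> (\<Sum>D | D \<in> \<F> \<and> D \<subseteq> A \<union> {}. 1)"
    using assms by (intro sum_mono2) auto
  then show ?thesis unfolding danger_def by simp
qed

text \<open>The choice of \<open>c\<close> makes Avoider's gain \<open>b / k\<close> times the
  danger of \<open>e\<close>. Each of Enforcer's \<open>b\<close> edges has at least that danger
  after Avoider's move, since \<open>e\<close> was minimal before it and dangers only grew. By
  double counting the loss is at least the gain.\<close>

lemma danger_round: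
  assumes "finite \<F>" "finite U" "0 < k" and k: "\<And>D. D \<in> \<F> \<Longrightarrow> finite D \<and> card D \<le> k"
    and "A \<inter> U = {}" and c: "c = 1 + real b / real k"
    and e: "e \<in> U" and e_min: "\<And>f. f \<in> U \<Longrightarrow> edge_danger c \<F> A U e \<le> edge_danger c \<F> A U f"
    and M: "M \<subseteq> U - {e}" "card M = b"
  shows "danger c \<F> (insert e A) (U - {e} - M) \<le> danger c \<F> A U"
proof -
  have c1: "1 \<le> c" using c by simp
  then have c0: "0 < c" by simp
  have "real b * edge_danger c \<F> A U e = (\<Sum>f\<in>M. edge_danger c \<F> A U e)" using M by simp
  also have "\<dots> \<le> (\<Sum>f\<in>M. edge_danger c \<F> (insert e A) (U - {e}) f)"
    using M e_min edge_danger_avoider_move[OF assms(1,2) c1 e]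
    by (intro sum_mono) (meson Diff_iff order_trans subsetD)
  also have "\<dots> \<le> real k * (danger c \<F> (insert e A) (U - {e}) - danger c \<F> (insert e A) (U - {e} - M))"
    using assms by (intro sum_edge_danger_le) (auto simp: add_pos_nonneg)
  finally have "real b / real k * edge_danger c \<F> A U e \<le>
      danger c \<F> (insert e A) (U - {e}) - danger c \<F> (insert e A) (U - {e} - M)"
    using \<open>0 < k\<close> by (simp add: field_simps)
  moreover have "danger c \<F> (insert e A) (U - {e}) =
      danger c \<F> A U + real b / real k * edge_danger c \<F> A U e"
    using danger_avoider_move[OF assms(1,2) c0 e, of A] unfolding c by simp
  ultimately show ?thesis by linarith
qed

text \<open>By averaging, the minimal edge danger is at most \<open>k / card U\<close> times the
  total weight, so Avoider's gain is at most the fraction \<open>b / card U\<close> of it.\<close>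

lemma danger_last_move:
  assumes "finite \<F>" "finite U" "0 < k" and k: "\<And>D. D \<in> \<F> \<Longrightarrow> finite D \<and> card D \<le> k"
    and "A \<inter> U = {}" and c: "c = 1 + real b / real k"
    and e: "e \<in> U" and e_min: "\<And>f. f \<in> U \<Longrightarrow> edge_danger c \<F> A U e \<le> edge_danger c \<F> A U f"
  shows "danger c \<F> (insert e A) {} \<le> (1 + real b / real (card U)) * danger c \<F> A U"
proof -
  have c1: "1 \<le> c" using c by simp
  then have c0: "0 < c" by simp
  have U0: "card U > 0" using e assms(2) card_gt_0_iff by blast
  have "real (card U) * edge_danger c \<F> A U e \<le> (\<Sum>f\<in>U. edge_danger c \<F> A U f)"
    using e_min by (intro sum_bounded_below) auto
  also have "\<dots> \<le> real k * (danger c \<F> A U - danger c \<F> A (U - U))"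
    using assms by (intro sum_edge_danger_le) (auto simp: add_pos_nonneg)
  also have "\<dots> \<le> real k * danger c \<F> A U" using danger_nonneg[OF c0, of \<F> A "{}"]
    by (intro mult_left_mono) auto
  finally have *: "edge_danger c \<F> A U e \<le> real k * danger c \<F> A U / real (card U)"
    using U0 by (simp add: field_simps)
  \<comment> \<open>Giving all remaining edges to Enforcer cannot raise the weight: apply the double
    count with \<open>M\<close> all of them, whose left side is nonnegative.\<close>
  have "0 \<le> (\<Sum>f\<in>U - {e}. edge_danger c \<F> (insert e A) (U - {e}) f)"
    using c1 by (auto intro!: sum_nonneg simp: edge_danger_def)
  also have "\<dots> \<le> real k * (danger c \<F> (insert e A) (U - {e}) - danger c \<F> (insert e A) (U - {e} - (U - {e})))"
    using assms by (intro sum_edge_danger_le) (auto simp: add_pos_nonneg)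
  finally have "danger c \<F> (insert e A) {} \<le> danger c \<F> (insert e A) (U - {e})"
    using \<open>0 < k\<close> by (simp add: zero_le_mult_iff)
  also have "\<dots> = danger c \<F> A U + real b / real k * edge_danger c \<F> A U e"
    using danger_avoider_move[OF assms(1,2) c0 e, of A] unfolding c by simp
  also have "\<dots> \<le> danger c \<F> A U + real b / real k * (real k * danger c \<F> A U / real (card U))"
    using * by (intro add_left_mono mult_left_mono) auto
  also have "\<dots> = (1 + real b / real (card U)) * danger c \<F> A U"
    using \<open>0 < k\<close> by (simp add: field_simps)
  finally show ?thesis .
qed

section \<open>Avoider's strategy\<close>

lemma avoider_edges_snoc:
  "avoider_edges (ms @ [M]) = (if even (length ms) then avoider_edges ms \<union> M else avoider_edges ms)"
proof -
  have "{(ms @ [M]) ! i |i. i < length (ms @ [M]) \<and> even i} =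
      {ms ! i |i. i < length ms \<and> even i} \<union> (if even (length ms) then {M} else {})" (is "?L = ?R")
  proof (intro equalityI subsetI)
    fix x assume "x \<in> ?L"
    then obtain i where "x = (ms @ [M]) ! i" "i < Suc (length ms)" "even i" by auto
    then show "x \<in> ?R" by (cases "i = length ms") (auto simp: nth_append)
  next
    fix x assume x: "x \<in> ?R"
    show "x \<in> ?L"
    proof (cases "x \<in> {ms ! i |i. i < length ms \<and> even i}")
      case True
      then obtain i where "x = ms ! i" "i < length ms" "even i" by auto
      then have "x = (ms @ [M]) ! i \<and> i < length (ms @ [M]) \<and> even i" by (simp add: nth_append)
      then show ?thesis by blast
    next
      case False
      with x have "x = (ms @ [M]) ! length ms \<and> length ms < length (ms @ [M]) \<and> even (length ms)"
        by (auto split: if_splits)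
      then show ?thesis by blast
    qed
  qed
  then show ?thesis unfolding avoider_edges_def by auto
qed

lemma follows_snoc:
  "follows \<sigma> (ms @ [M]) \<longleftrightarrow> follows \<sigma> ms \<and> (odd (length ms) \<longrightarrow> M = \<sigma> ms)"
  unfolding follows_def by (auto simp: less_Suc_eq nth_append)

lemma unclaimed_snoc: "unclaimed X (ms @ [M]) = unclaimed X ms - M"
  unfolding unclaimed_def by auto

lemma avoider_edges_unclaimed: "avoider_edges ms \<inter> unclaimed X ms = {}"
  unfolding avoider_edges_def unclaimed_def by auto

text \<open>Induction over positions with Avoider to move. A full round removes \<open>b + 1\<close>
  edges, so it preserves the remainder \<open>r\<close>, and it does not raise the weight. The
  factor \<open>1 + b / r\<close> is held in reserve for the last round, which starts with exactly
  \<open>r\<close> free edges.\<close>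

lemma avoider_escapes:
  assumes X: "finite X" and \<F>: "finite \<F>" and "0 < k"
    and k: "\<And>D. D \<in> \<F> \<Longrightarrow> finite D \<and> card D \<le> k"
    and c: "c = 1 + real b / real k" and b: "0 < b" and r: "0 < r" "r \<le> b"
    and \<sigma>: "enforcer_strategy X b \<sigma>"
    and "play X b ms" "follows \<sigma> ms" "even (length ms)"
    and "card (unclaimed X ms) mod (b + 1) = r"
    and "(1 + real b / real r) * danger c \<F> (avoider_edges ms) (unclaimed X ms) < 1"
  shows "\<exists>ms'. play X b ms' \<and> follows \<sigma> ms' \<and> finished X ms' \<and> (\<forall>D\<in>\<F>. \<not> D \<subseteq> avoider_edges ms')"
  using assms(10-)
proof (induction "card (unclaimed X ms)" arbitrary: ms rule: less_induct)
  case less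
  let ?U = "unclaimed X ms" and ?A = "avoider_edges ms"
  have c1: "1 \<le> c" using c by simp
  have finU: "finite ?U" using X unfolding unclaimed_def by auto
  have U: "?U \<noteq> {}" using less.prems(4) r by auto
  obtain e where e: "e \<in> ?U"
    and e_min: "\<And>f. f \<in> ?U \<Longrightarrow> edge_danger c \<F> ?A ?U e \<le> edge_danger c \<F> ?A ?U f"
    using ex_is_arg_min_if_finite[OF finU U, of "edge_danger c \<F> ?A ?U"]
    by (auto simp: is_arg_min_linorder)
  define ms1 where "ms1 = ms @ [{e}]"
  have U1: "unclaimed X ms1 = ?U - {e}" unfolding ms1_def unclaimed_snoc ..
  have A1: "avoider_edges ms1 = insert e ?A"
    using less.prems(3) by (simp add: ms1_def avoider_edges_snoc)
  have p1: "play X b ms1" unfolding ms1_def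
    using less.prems e U by (intro play.move) (auto simp: legal_move_def)
  have f1: "follows \<sigma> ms1" using less.prems by (simp add: ms1_def follows_snoc)
  have o1: "odd (length ms1)" using less.prems by (simp add: ms1_def)
  have cU1: "card (unclaimed X ms1) = card ?U - 1" using e finU by (simp add: U1)
  define M where "M = \<sigma> ms1"
  define ms2 where "ms2 = ms1 @ [M]"
  \<comment> \<open>This covers both endings: Avoider's edge may be the last one, or Enforcer takes
    all the rest.\<close>
  have fin_case: "\<forall>D\<in>\<F>. \<not> D \<subseteq> insert e ?A" if "card ?U \<le> b"
  proof
    fix D assume D: "D \<in> \<F>"
    have "card ?U = r" using that less.prems(4) by simp
    then have "danger c \<F> (insert e ?A) {} < 1"
      using danger_last_move[OF \<F> finU \<open>0 < k\<close> k avoider_edges_unclaimed c e e_min] less.prems(5)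
      by simp
    then show "\<not> D \<subseteq> insert e ?A" using danger_ge_1[OF \<F> _ D, of c "insert e ?A"] c1 by auto
  qed
  show ?case
  proof (cases "finished X ms1")
    case True
    then have "card ?U \<le> b" using cU1 b unfolding finished_def by auto
    then show ?thesis using p1 f1 True fin_case A1 by auto
  next
    case False
    then have M: "legal_move X b ms1 M"
      using \<sigma> p1 f1 o1 unfolding enforcer_strategy_def M_def by blast
    then have Msub: "M \<subseteq> ?U - {e}" and cM: "card M = min b (card (unclaimed X ms1))"
      using o1 unfolding legal_move_def U1 by auto
    have p2: "play X b ms2" unfolding ms2_def
      using False M p1 by (intro play.move) (auto simp: finished_def)
    have f2: "follows \<sigma> ms2" using f1 by (simp add: ms2_def follows_snoc M_def)
    have e2: "even (length ms2)" using o1 by (simp add: ms2_def)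
    have A2: "avoider_edges ms2 = insert e ?A" using o1 A1 by (simp add: ms2_def avoider_edges_snoc)
    have U2: "unclaimed X ms2 = ?U - {e} - M" unfolding ms2_def unclaimed_snoc U1 ..
    show ?thesis
    proof (cases "card ?U \<le> b")
      case True
      then have "card M = card (?U - {e})" using cM cU1 U1 by simp
      then have "M = ?U - {e}" using Msub finU by (intro card_subset_eq) auto
      then have "finished X ms2" unfolding finished_def U2 by simp
      then show ?thesis using p2 f2 fin_case True A2 by auto
    next
      case big: False
      have "card ?U \<noteq> b + 1" using less.prems(4) r by auto
      with big have big': "card ?U > b + 1" by simp
      then have cMb: "card M = b" using cM cU1 by simp
      have "card (unclaimed X ms2) = card (?U - {e}) - b" unfolding U2
        using Msub finU cMb by (simp add: card_Diff_subset finite_subset)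
      then have cU2: "card (unclaimed X ms2) = card ?U - (b + 1)" using e finU by simp
      have mod2: "card (unclaimed X ms2) mod (b + 1) = r"
        using cU2 big' less.prems(4) by (metis le_mod_geq less_imp_le)
      have "danger c \<F> (avoider_edges ms2) (unclaimed X ms2) \<le> danger c \<F> ?A ?U"
        unfolding A2 U2
        by (rule danger_round[OF \<F> finU \<open>0 < k\<close> k avoider_edges_unclaimed c e e_min Msub cMb])
      then have "(1 + real b / real r) * danger c \<F> (avoider_edges ms2) (unclaimed X ms2) \<le>
          (1 + real b / real r) * danger c \<F> ?A ?U"
        by (intro mult_left_mono) auto
      then show ?thesis
        using less.hyps[of ms2] cU2 big' p2 f2 e2 mod2 less.prems(5) by simp
    qed
  qed
qed

section \<open>Biases leaving a large remainder\<close>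

text \<open>
  The sign is opposite to the usual difference operator, so that the iterated differences of
  \<open>x / a\<close> are positive.
\<close>

fun iter_diff :: "(nat \<Rightarrow> 'a::ab_group_add) \<Rightarrow> nat \<Rightarrow> nat \<Rightarrow> 'a" where
  "iter_diff f 0 a = f a"
| "iter_diff f (Suc k) a = iter_diff f k a - iter_diff f k (Suc a)"

text \<open>Two neighbouring differences share the factors \<open>a + 1\<close> to
  \<open>a + k\<close>; subtracting leaves \<open>1 / a - 1 / (a + k + 1)\<close>, whose numerator
  \<open>k + 1\<close> extends the factorial. Positivity, monotonicity in \<open>a\<close> and the
  decay from \<open>a\<close> to \<open>2 * a\<close> can be read off.\<close>

lemma iter_diff_inverse:
  assumes "0 < a"
  shows "iter_diff (\<lambda>a. x / real a) k a = x * fact k / (\<Prod>i\<le>k. real (a + i))"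
  using assms
proof (induction k arbitrary: a)
  case 0
  then show ?case by simp
next
  case (Suc k)
  define P where "P = (\<Prod>i<k. real (Suc a + i))"
  have P: "P > 0" unfolding P_def by (intro prod_pos) auto
  have 1: "(\<Prod>i\<le>k. real (a + i)) = real a * P"
    unfolding P_def by (simp add: prod.atMost_shift add_ac)
  have 2: "(\<Prod>i\<le>k. real (Suc a + i)) = P * real (Suc a + k)"
    unfolding P_def by (simp add: lessThan_Suc_atMost[symmetric])
  have 3: "(\<Prod>i\<le>Suc k. real (a + i)) = real a * P * real (Suc a + k)"
    using 1 by simp
  have "iter_diff (\<lambda>a. x / real a) (Suc k) a
      = x * fact k / (real a * P) - x * fact k / (P * real (Suc a + k))"
    using Suc.IH[of a] Suc.IH[of "Suc a"] Suc.prems unfolding 1 2 by simp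
  also have "\<dots> = x * fact k * (real (Suc a + k) - real a) / (real a * P * real (Suc a + k))"
    using P Suc.prems by (simp add: divide_simps) (simp add: algebra_simps)
  also have "\<dots> = x * fact (Suc k) / (real a * P * real (Suc a + k))"
    by (simp add: algebra_simps)
  finally show ?case using 3 by simp
qed

text \<open>Each differencing at most doubles the error, while differences of integers stay
  integers.\<close>

lemma iter_diff_floor_close:
  assumes "\<And>j. j \<le> k \<Longrightarrow> \<bar>f (a + j) - real_of_int (s (a + j))\<bar> < \<epsilon>"
  shows "\<bar>iter_diff f k a - real_of_int (iter_diff s k a)\<bar> < 2 ^ k * \<epsilon>"
  using assms
proof (induction k arbitrary: a)
  case 0
  then show ?case using 0[of 0] by simp
next
  case (Suc k)
  have "\<bar>iter_diff f k a - real_of_int (iter_diff s k a)\<bar> < 2 ^ k * \<epsilon>"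
    by (rule Suc.IH) (use Suc.prems in simp)
  moreover have "\<bar>iter_diff f k (Suc a) - real_of_int (iter_diff s k (Suc a))\<bar> < 2 ^ k * \<epsilon>"
    by (rule Suc.IH) (use Suc.prems[of "Suc _"] in simp)
  ultimately show ?case by simp
qed

text \<open>If all remainders were small, some iterated difference of \<open>N / a\<close> would
  stay near one positive integer on \<open>[A, 2 A]\<close>, although it at least halves
  there.\<close>

lemma exists_large_remainder:
  fixes N A K :: nat
  assumes AN: "A \<le> N" and A: "0 < A" and KA: "4 * N * fact K \<le> A ^ (K + 1)"
  shows "\<exists>a. A \<le> a \<and> a \<le> 2 * A + K \<and> a \<le> 2 ^ (K + 3) * (N mod a)"
proof (rule ccontr)
  assume "\<not> ?thesis"
  then have small: "2 ^ (K + 3) * (N mod a) < a" if "A \<le> a" "a \<le> 2 * A + K" for a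
    using that not_le by blast
  define f where "f = (\<lambda>a. real N / real a)"
  define s where "s = (\<lambda>a. int (N div a))"
  have fs: "\<bar>f a - real_of_int (s a)\<bar> < 1 / 2 ^ (K + 3)" if a: "A \<le> a" "a \<le> 2 * A + K" for a
  proof -
    have a0: "0 < a" using a A by simp
    have "real N = real a * real (N div a) + real (N mod a)"
      by (metis mult_div_mod_eq of_nat_add of_nat_mult)
    then have "f a - real_of_int (s a) = real (N mod a) / real a"
      using a0 by (simp add: f_def s_def field_simps)
    moreover have "real (N mod a) / real a < 1 / 2 ^ (K + 3)"
    proof -
      have "real (2 ^ (K + 3) * (N mod a)) < real a" using small[OF a] of_nat_less_iff by blast
      then show ?thesis using a0 by (simp add: field_simps)
    qed
    ultimately show ?thesis by simp
  qed
  \<comment> \<open>The factor \<open>2 ^ (K + 3)\<close> absorbs \<open>K\<close> doublings of the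
    error and leaves \<open>1 / 8\<close>. The range reaches \<open>2 * A + K\<close> because a
    \<open>k\<close>-th difference at \<open>a\<close> reads values up to
    \<open>a + k\<close>.\<close>
  have close: "\<bar>iter_diff f k a - real_of_int (iter_diff s k a)\<bar> < 1 / 8"
    if "A \<le> a" "a \<le> 2 * A" "k \<le> K" for k a
  proof -
    have "\<bar>iter_diff f k a - real_of_int (iter_diff s k a)\<bar> < 2 ^ k * (1 / 2 ^ (K + 3))"
      by (rule iter_diff_floor_close) (use that fs in simp)
    also have "\<dots> \<le> 2 ^ K * (1 / 2 ^ (K + 3))"
      using that by (intro mult_right_mono power_increasing) auto
    finally show ?thesis by (simp add: power_add)
  qed
  have val: "iter_diff f k a = real N * fact k / (\<Prod>i\<le>k. real (a + i))" if "A \<le> a" for k a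
    unfolding f_def using that A by (intro iter_diff_inverse) simp
  have "iter_diff f K A \<le> 1 / 4"
  proof -
    have "real (4 * N * fact K) \<le> real (A ^ (K + 1))" using KA of_nat_le_iff by blast
    also have "\<dots> = (\<Prod>i\<le>K. real A)" by simp
    also have "\<dots> \<le> (\<Prod>i\<le>K. real (A + i))" by (intro prod_mono) auto
    finally have *: "4 * (real N * fact K) \<le> (\<Prod>i\<le>K. real (A + i))" by simp
    have "0 < (\<Prod>i\<le>K. real (A + i))" using A by (intro prod_pos) auto
    with * show ?thesis unfolding val[OF order_refl] by (simp add: field_simps)
  qed
  moreover have "\<not> iter_diff f 0 A \<le> 1 / 4"
  proof -
    have "1 \<le> f A" using AN A by (simp add: f_def)
    then show ?thesis by simp
  qed
  \<comment> \<open>The order \<open>k\<close> is chosen at the crossing: the difference itself is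
    still above \<open>1 / 4\<close>, but its steps, which are the differences of the next order,
    are not.\<close>
  ultimately obtain k where k: "k < K" "\<not> iter_diff f k A \<le> 1 / 4" "iter_diff f (Suc k) A \<le> 1 / 4"
    using ex_least_nat_less[of "\<lambda>k. iter_diff f k A \<le> 1 / 4" K] by auto
  \<comment> \<open>Steps of at most \<open>1 / 4\<close> and errors below \<open>1 / 8\<close> keep the nearest integer constant.\<close>
  have step: "\<bar>iter_diff f k a - iter_diff f k (Suc a)\<bar> \<le> 1 / 4" if "A \<le> a" for a
  proof -
    have "0 \<le> iter_diff f (Suc k) a" unfolding val[OF that] by (intro divide_nonneg_nonneg prod_nonneg) auto
    moreover have "iter_diff f (Suc k) a \<le> iter_diff f (Suc k) A"
      unfolding val[OF that] val[OF order_refl]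
      using A that by (intro divide_left_mono prod_mono mult_pos_pos prod_pos) auto
    ultimately show ?thesis using k(3) by simp
  qed
  have const: "iter_diff s k (A + j) = iter_diff s k A" if "j \<le> A" for j
    using that
  proof (induction j)
    case (Suc j)
    have "\<bar>real_of_int (iter_diff s k (A + j) - iter_diff s k (Suc (A + j)))\<bar> < 1"
    proof -
      have "\<bar>iter_diff f k (A + j) - real_of_int (iter_diff s k (A + j))\<bar> < 1 / 8"
        by (rule close) (use Suc.prems k(1) in auto)
      moreover have "\<bar>iter_diff f k (Suc (A + j)) - real_of_int (iter_diff s k (Suc (A + j)))\<bar> < 1 / 8"
        by (rule close) (use Suc.prems k(1) in auto)
      ultimately show ?thesis using step[OF le_add1, of j] unfolding of_int_diff by linarith
    qed
    then have "iter_diff s k (A + j) = iter_diff s k (Suc (A + j))" by linarith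
    then show ?case using Suc by simp
  qed simp
  \<comment> \<open>Passing from \<open>A\<close> to \<open>2 * A\<close> doubles the first factor
    of the denominator and does not decrease the others.\<close>
  have half: "iter_diff f k (2 * A) \<le> iter_diff f k A / 2"
  proof -
    define Q where "Q = (\<Prod>i<k. real (A + Suc i))"
    have Q: "0 < Q" unfolding Q_def by (intro prod_pos) auto
    have 1: "(\<Prod>i\<le>k. real (A + i)) = real A * Q"
      unfolding Q_def by (simp add: prod.atMost_shift add_ac)
    have "Q \<le> (\<Prod>i<k. real (2 * A + Suc i))" unfolding Q_def by (intro prod_mono) auto
    then have 2: "2 * (real A * Q) \<le> (\<Prod>i\<le>k. real (2 * A + i))"
      using A by (simp add: prod.atMost_shift add_ac)
    have "iter_diff f k (2 * A) \<le> real N * fact k / (2 * (real A * Q))"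
      using 2 A Q by (subst val) (auto intro!: divide_left_mono mult_pos_pos prod_pos)
    also have "\<dots> = iter_diff f k A / 2" using 1 by (simp add: val)
    finally show ?thesis .
  qed
  have c1: "\<bar>iter_diff f k A - real_of_int (iter_diff s k A)\<bar> < 1 / 8"
    using close[of A k] k(1) by simp
  have c2: "\<bar>iter_diff f k (2 * A) - real_of_int (iter_diff s k A)\<bar> < 1 / 8"
    using close[of "2 * A" k] const[of A] k(1) by (simp add: mult_2)
  have "0 < real_of_int (iter_diff s k A)" using c1 k(2) by linarith
  then have "1 \<le> iter_diff s k A" by simp
  then have "1 \<le> real_of_int (iter_diff s k A)" by simp
  \<comment> \<open>With \<open>z\<close> the common nearest integer,
    \<open>z - 1 / 8 < (z + 1 / 8) / 2\<close> forces \<open>z < 3 / 8\<close>.\<close>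
  then show False using c1 c2 half by linarith
qed

section \<open>Copies of a densest subgraph\<close>

text \<open>A copy is recorded by its edge set alone, which is all the game sees. Extensional maps
  make the index set finite, with at most \<open>n ^ card (verts F)\<close> elements.\<close>

definition copies :: "nat \<Rightarrow> 'a graph \<Rightarrow> nat set set set" where
  "copies n F = (\<lambda>\<phi>. (`) \<phi> ` edges F) ` {\<phi> \<in> verts F \<rightarrow>\<^sub>E {..<n}. inj_on \<phi> (verts F)}"

lemma finite_copies:
  assumes "finite (verts F)"
  shows "finite (copies n F)" and "card (copies n F) \<le> n ^ card (verts F)"
proof -
  let ?\<Phi> = "{\<phi> \<in> verts F \<rightarrow>\<^sub>E {..<n}. inj_on \<phi> (verts F)}"
  have fin: "finite (verts F \<rightarrow>\<^sub>E {..<n})" using assms by (intro finite_PiE) auto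
  then have fin': "finite ?\<Phi>" by simp
  then show "finite (copies n F)" unfolding copies_def by simp
  have "card (copies n F) \<le> card ?\<Phi>" unfolding copies_def by (rule card_image_le[OF fin'])
  also have "\<dots> \<le> card (verts F \<rightarrow>\<^sub>E {..<n})" using fin by (intro card_mono) auto
  also have "\<dots> = n ^ card (verts F)" using assms by (simp add: card_funcsetE)
  finally show "card (copies n F) \<le> n ^ card (verts F)" .
qed

lemma copies_member:
  assumes F: "simple_graph F" and D: "D \<in> copies n F"
  shows "D \<subseteq> edges (complete_graph n)" "finite D" "card D = card (edges F)"
proof -
  obtain \<phi> where \<phi>: "\<phi> \<in> verts F \<rightarrow>\<^sub>E {..<n}" "inj_on \<phi> (verts F)" "D = (`) \<phi> ` edges F"
    using D unfolding copies_def by auto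
  have sub: "e \<subseteq> verts F" "card e = 2" if "e \<in> edges F" for e
    using that F unfolding simple_graph_def by auto
  have "card (\<phi> ` e) = 2" if "e \<in> edges F" for e
    using sub[OF that] \<phi>(2) by (metis card_image inj_on_subset)
  moreover have "\<phi> ` e \<subseteq> {..<n}" if "e \<in> edges F" for e
    using sub[OF that] \<phi>(1) by auto
  ultimately show "D \<subseteq> edges (complete_graph n)" unfolding \<phi>(3) complete_graph_def by auto
  have "finite (edges F)"
    using F unfolding simple_graph_def by (auto intro: finite_subset[of _ "Pow (verts F)"])
  then show "finite D" using \<phi>(3) by simp
  have "inj_on ((`) \<phi>) (edges F)"
    using \<phi>(2) sub(1) unfolding inj_on_def[of "(`) \<phi>"] by (metis inj_on_image_eq_iff)
  then show "card D = card (edges F)" unfolding \<phi>(3) by (rule card_image)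
qed

text \<open>An embedding of \<open>H\<close> restricts to \<open>F\<close>, so Avoider may aim at
  avoiding \<open>F\<close> only.\<close>

lemma contains_copy_copies:
  assumes "subgraph F H" and "contains_copy \<lparr>verts = {..<n}, edges = E\<rparr> H"
  shows "\<exists>D\<in>copies n F. D \<subseteq> E"
proof -
  obtain \<phi> where \<phi>: "inj_on \<phi> (verts H)" "\<phi> ` verts H \<subseteq> {..<n}" "\<forall>e\<in>edges H. \<phi> ` e \<in> E"
    using assms(2) unfolding contains_copy_def by auto
  have F: "simple_graph F" "verts F \<subseteq> verts H" "edges F \<subseteq> edges H"
    using assms(1) unfolding subgraph_def by auto
  let ?\<psi> = "restrict \<phi> (verts F)"
  have "?\<psi> \<in> verts F \<rightarrow>\<^sub>E {..<n}" using \<phi>(2) F(2) by auto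
  moreover have "inj_on ?\<psi> (verts F)" using inj_on_subset[OF \<phi>(1) F(2)] by simp
  ultimately have "(`) ?\<psi> ` edges F \<in> copies n F" unfolding copies_def by blast
  moreover have "?\<psi> ` e = \<phi> ` e" if "e \<in> edges F" for e
    using that F(1) unfolding simple_graph_def by auto
  then have "(`) ?\<psi> ` edges F \<subseteq> E" using \<phi>(3) F(3) by auto
  ultimately show ?thesis by blast
qed

text \<open>Initially each copy has weight \<open>(1 / c) ^ k\<close>, where
  \<open>1 / c = k / (k + b)\<close> is at most \<open>k / b\<close>. The assumption
  \<open>weight\<close> thus bounds the initial danger as the induction requires.\<close>

lemma avoider_wins:
  fixes H F :: "'a graph"
  assumes F: "subgraph F H" and k: "k = card (edges F)" "0 < k"
    and b: "0 < b" and r: "r = card (edges (complete_graph n)) mod (b + 1)" "0 < r"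
    and weight: "(1 + real b / real r) * (real n ^ card (verts F) * (real k / real b) ^ k) < 1"
  shows "\<not> enforcer_wins H n b"
proof
  assume "enforcer_wins H n b"
  define X where "X = edges (complete_graph n)"
  obtain \<sigma> where \<sigma>: "enforcer_strategy X b \<sigma>"
    and win: "\<And>ms. play X b ms \<Longrightarrow> follows \<sigma> ms \<Longrightarrow> finished X ms \<Longrightarrow>
      contains_copy \<lparr>verts = {..<n}, edges = avoider_edges ms\<rparr> H"
    using \<open>enforcer_wins H n b\<close> unfolding enforcer_wins_def X_def by (auto simp: complete_graph_def)
  have X: "finite X" unfolding X_def complete_graph_def
    by (auto intro: finite_subset[of _ "Pow {..<n}"])
  have sF: "simple_graph F" using F unfolding subgraph_def by simp
  then have vF: "finite (verts F)" unfolding simple_graph_def by simp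
  define c where "c = 1 + real b / real k"
  have c: "1 \<le> c" unfolding c_def by simp
  have U0: "unclaimed X [] = X" unfolding unclaimed_def by simp
  have A0: "avoider_edges [] = ({} :: nat set set)" unfolding avoider_edges_def by simp
  have "danger c (copies n F) {} X \<le> (\<Sum>D\<in>copies n F. (1 / c) ^ k)"
  proof -
    have "danger c (copies n F) {} X = (\<Sum>D | D \<in> copies n F \<and> D \<subseteq> {} \<union> X. (1 / c) ^ k)"
      unfolding danger_def
      using copies_member[OF sF] k(1) by (intro sum.cong refl) (auto simp: Int_absorb2 X_def)
    also have "\<dots> \<le> (\<Sum>D\<in>copies n F. (1 / c) ^ k)"
      using finite_copies[OF vF] c by (intro sum_mono2) auto
    finally show ?thesis .
  qed
  also have "\<dots> = real (card (copies n F)) * (1 / c) ^ k" by simp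
  also have "\<dots> \<le> real n ^ card (verts F) * (real k / real b) ^ k"
  proof (intro mult_mono power_mono)
    show "real (card (copies n F)) \<le> real n ^ card (verts F)"
      using finite_copies(2)[OF vF, of n] by (metis of_nat_le_iff of_nat_power)
    show "1 / c \<le> real k / real b" using b k(2) unfolding c_def by (simp add: field_simps)
  qed (use c in auto)
  finally have "(1 + real b / real r) * danger c (copies n F) {} X \<le>
      (1 + real b / real r) * (real n ^ card (verts F) * (real k / real b) ^ k)"
    by (intro mult_left_mono) auto
  then have d: "(1 + real b / real r) * danger c (copies n F) (avoider_edges []) (unclaimed X []) < 1"
    unfolding A0 U0 using weight by linarith
  have "r \<le> b" using r(1) mod_less_divisor[of "b + 1" "card (edges (complete_graph n))"] by simp
  then obtain ms where "play X b ms" "follows \<sigma> ms" "finished X ms"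
      "\<forall>D\<in>copies n F. \<not> D \<subseteq> avoider_edges ms"
    using avoider_escapes[OF X finite_copies(1)[OF vF] k(2) _ c_def b r(2) _ \<sigma> play.start _ _ _ d]
      copies_member[OF sF] k(1) r(1) U0 by (auto simp: follows_def X_def)
  then show False using win contains_copy_copies[OF F] by blast
qed

text \<open>Densities depend only on a pair of subsets of \<open>verts H\<close> and
  \<open>edges H\<close>, so there are finitely many. The maximum is at least the positive density
  of \<open>H\<close> itself, which gives the maximizer an edge.\<close>

lemma max_density_attained:
  assumes "simple_graph H" and "edges H \<noteq> {}"
  obtains F where "subgraph F H" "verts F \<noteq> {}" "edges F \<noteq> {}" "finite (edges F)"
    "max_density H = real (card (edges F)) / real (card (verts F))"
proof -
  let ?d = "\<lambda>F::'a graph. real (card (edges F)) / real (card (verts F))"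
  let ?S = "{?d F |F. subgraph F H \<and> verts F \<noteq> {}}"
  have finV: "finite (verts H)" and finE: "finite (edges H)"
    using assms(1) unfolding simple_graph_def by (auto intro: finite_subset[of _ "Pow (verts H)"])
  have "?S \<subseteq> (\<lambda>(V, E). real (card E) / real (card V)) ` (Pow (verts H) \<times> Pow (edges H))"
    unfolding subgraph_def by (force simp: image_iff)
  then have fin: "finite ?S" using finV finE by (meson finite_Pow_iff finite_SigmaI finite_imageI finite_subset)
  have sub: "subgraph H H" using assms(1) unfolding subgraph_def by simp
  have vH: "verts H \<noteq> {}" using assms unfolding simple_graph_def by fastforce
  have HS: "?d H \<in> ?S" using sub vH by blast
  have "max_density H \<in> ?S" unfolding max_density_def using fin HS by (intro Max_in) auto
  then obtain F where F: "subgraph F H" "verts F \<noteq> {}" "max_density H = ?d F" by auto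
  have "0 < ?d H" using assms vH finV finE by (auto simp: card_gt_0_iff)
  also have "?d H \<le> max_density H" unfolding max_density_def using fin HS by (intro Max_ge) auto
  finally have "edges F \<noteq> {}" using F(3) by auto
  moreover have "finite (edges F)" using F(1) finE finite_subset unfolding subgraph_def by blast
  ultimately show ?thesis using that F by blast
qed

section \<open>Choice of the constants and the asymptotic bound\<close>

theorem theorem1p1:
  fixes H :: "'a graph"
  assumes "simple_graph H" and "card (edges H) \<ge> 2"
  shows "(\<lambda>n. real (lower_threshold H n)) \<in> O(\<lambda>n. real n powr (1 / max_density H))"
proof -
  have H_edges: "edges H \<noteq> {}" using assms(2) by auto
  obtain F where F: "subgraph F H" "verts F \<noteq> {}" "edges F \<noteq> {}" "finite (edges F)"
    and m: "max_density H = real (card (edges F)) / real (card (verts F))"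
    using max_density_attained[OF assms(1) H_edges] .
  define k v where "k = card (edges F)" and "v = card (verts F)"
  have k: "0 < k" using F(3,4) by (simp add: k_def card_gt_0_iff)
  have v: "0 < v"
    using F(1,2) by (simp add: v_def card_gt_0_iff subgraph_def simple_graph_def)
  \<comment> \<open>Since \<open>x ^ k = n ^ v\<close> is at least \<open>n\<close>, the exponent
    \<open>2 * k\<close> reaches \<open>n ^ 2\<close> and hence \<open>N\<close>.\<close>
  define K where "K = 2 * k"
  \<comment> \<open>The first summand makes the final weight less than 1, and the \<open>+ 1\<close>
    makes this strict; \<open>4 * fact K\<close> serves the size condition for finding a large
    remainder.\<close>
  define C :: real where "C = 2 * real k * (1 + 2 ^ (K + 3)) + 1 + 4 * fact K"
  have "0 \<le> 2 * real k * 2 ^ (K + 3)" by simp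
  moreover have "real K = 2 * real k" by (simp add: K_def)
  moreover have "1 \<le> (fact K :: real)" by simp
  ultimately have C: "2 * real k \<le> C" "4 * fact K \<le> C" "2 * real k * (1 + 2 ^ (K + 3)) < C" "5 \<le> C" "real K \<le> C"
    unfolding C_def distrib_left mult_1_right by linarith+
  \<comment> \<open>The factor 6 comes from \<open>b < 3 * A\<close> and
    \<open>A \<le> 2 * C * x\<close>.\<close>
  have bound: "real (lower_threshold H n) \<le> 6 * C * (real n powr (1 / max_density H))"
    if n: "1 \<le> n" for n
  proof -
    define N where "N = card (edges (complete_graph n))"
    define x where "x = real n powr (real v / real k)"
    have x_eq: "x = real n powr (1 / max_density H)" unfolding x_def m k_def v_def by simp
    have x1: "1 \<le> x" unfolding x_def using n by (intro ge_one_powr_ge_zero) auto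
    have xk: "x ^ k = real n ^ v"
      using n k by (simp add: x_def powr_realpow[symmetric] powr_powr)
    define A where "A = nat \<lceil>C * x\<rceil>"
    have Cx: "C \<le> C * x" using x1 C by simp
    have A: "C * x \<le> real A" "real A \<le> C * x + 1" unfolding A_def using Cx C by linarith+
    have A2: "real A \<le> 2 * C * x" "5 \<le> A" "K \<le> A" using A Cx C by linarith+
    have le_if: "lower_threshold H n \<le> 3 * A \<Longrightarrow> ?thesis" using A2 unfolding x_eq by linarith
    show ?thesis
    proof (cases "A \<le> N")
      \<comment> \<open>A bias at which Enforcer wins is below \<open>N\<close>, which here is
        already less than \<open>A\<close>.\<close>
      case False
      have "lower_threshold H n \<le> N"
      proof (cases "lower_threshold H n = 0")
        case False
        then have "enforcer_wins H n (lower_threshold H n)"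
          using lower_threshold_greatest(1)[OF assms] by simp
        then show ?thesis using enforcer_wins_bias_less[OF assms] unfolding N_def by (simp add: less_imp_le)
      qed simp
      with False show ?thesis by (intro le_if) simp
    next
      case AN: True
      have "N = n choose 2" unfolding N_def complete_graph_def using n_subsets[of "{..<n}" 2] by simp
      then have "N \<le> n * (n - 1)" by (simp add: choose_two)
      also have "\<dots> \<le> n ^ 2" by (simp add: power2_eq_square)
      finally have N: "real N \<le> real n ^ 2"
        using of_nat_mono[of N "n ^ 2", where 'a = real] by simp
      have "real (4 * N * fact K) \<le> real (A ^ (K + 1))"
      proof -
        have "real n \<le> x ^ k" unfolding xk using n v self_le_power[of "real n" v] by simp
        then have "real n ^ 2 \<le> (x ^ k) ^ 2" by (intro power_mono) auto
        also have "\<dots> = x ^ K" unfolding K_def by (simp add: power_mult[symmetric] mult.commute)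
        also have "\<dots> \<le> x ^ (K + 1)" using x1 by (intro power_increasing) auto
        finally have "real N \<le> x ^ (K + 1)" using N by linarith
        moreover have "C \<le> C ^ (K + 1)" by (rule self_le_power) (use C in auto)
        then have "4 * fact K \<le> C ^ (K + 1)" using C(2) by linarith
        ultimately have "(4 * fact K) * real N \<le> C ^ (K + 1) * x ^ (K + 1)"
          using \<open>C \<le> C ^ (K + 1)\<close> C(4) by (intro mult_mono) linarith+
        also have "\<dots> = (C * x) ^ (K + 1)" by (rule power_mult_distrib[symmetric])
        also have "\<dots> \<le> real A ^ (K + 1)" using A(1) C x1 by (intro power_mono) auto
        finally show ?thesis by (simp add: mult_ac)
      qed
      then have "4 * N * fact K \<le> A ^ (K + 1)" by (simp only: of_nat_le_iff)
      then obtain a where a: "A \<le> a" "a \<le> 2 * A + K" "a \<le> 2 ^ (K + 3) * (N mod a)"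
        using exists_large_remainder[OF AN] A2 by auto
      \<comment> \<open>A full round uses \<open>b + 1\<close> edges, so the modulus
        \<open>a\<close> corresponds to the bias \<open>a - 1\<close>. Replacing \<open>b\<close> by
        \<open>A / 2\<close> in the estimates below accounts for the factor 2 in
        \<open>C\<close>.\<close>
      define b r where "b = a - 1" and "r = N mod a"
      have ab: "a = b + 1" and b: "0 < b" using a(1) A2(2) unfolding b_def by auto
      have r: "0 < r" using a(3) ab unfolding r_def by (cases "N mod a = 0") auto
      have "real a \<le> real (2 ^ (K + 3) * r)" using a(3) unfolding r_def by (simp only: of_nat_le_iff)
      then have "real b \<le> 2 ^ (K + 3) * real r" using ab by simp
      then have br: "real b / real r \<le> 2 ^ (K + 3)" using r by (simp add: field_simps)
      have "real A \<le> 2 * real b" using a(1) A2(2) ab by linarith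
      then have "real k / real b \<le> (2 * real k / C) / x"
      proof -
        have "C * x \<le> 2 * real b" using A(1) \<open>real A \<le> 2 * real b\<close> by linarith
        then have "2 * real k / (2 * real b) \<le> 2 * real k / (C * x)"
          using C x1 b by (intro divide_left_mono) auto
        then show ?thesis by simp
      qed
      then have "(real k / real b) ^ k \<le> ((2 * real k / C) / x) ^ k"
        by (intro power_mono) auto
      also have "\<dots> = (2 * real k / C) ^ k / real n ^ v" by (simp only: power_divide xk)
      finally have "(real k / real b) ^ k * real n ^ v \<le> (2 * real k / C) ^ k"
        using n by (simp only: pos_le_divide_eq zero_less_power of_nat_0_less_iff Suc_le_eq One_nat_def)
      \<comment> \<open>Dropping the exponent, as the base is at most 1, avoids a
        \<open>k\<close>-th root in the choice of \<open>C\<close>.\<close>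
      also have "\<dots> \<le> (2 * real k / C) ^ 1"
        using C(1,4) k by (intro power_decreasing) (auto simp: divide_le_eq_1)
      finally have small: "real n ^ v * (real k / real b) ^ k \<le> 2 * real k / C"
        by (simp only: power_one_right mult.commute)
      have "(1 + real b / real r) * (real n ^ v * (real k / real b) ^ k) \<le>
          (1 + 2 ^ (K + 3)) * (2 * real k / C)"
        by (rule mult_mono[OF add_left_mono[OF br] small]) simp_all
      also have "\<dots> = 2 * real k * (1 + 2 ^ (K + 3)) / C" by simp
      also have "\<dots> < 1" using C(3,4) by (subst divide_less_eq_1_pos) linarith+
      finally have weight: "(1 + real b / real r) * (real n ^ v * (real k / real b) ^ k) < 1" .
      have "r = card (edges (complete_graph n)) mod (b + 1)" unfolding r_def N_def ab ..
      from avoider_wins[OF F(1) k_def k b this r weight[unfolded v_def]]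
      have "\<not> enforcer_wins H n b" .
      \<comment> \<open>One bias lost by Enforcer suffices: he wins at every positive bias up to the
        lower threshold.\<close>
      then have "lower_threshold H n < b"
        using lower_threshold_greatest(1)[OF assms, of n] b by (intro ccontr[of "lower_threshold H n < b"]) auto
      then show ?thesis using a(2) A2(3) ab by (intro le_if) simp
    qed
  qed
  show ?thesis
  proof (rule bigoI)
    show "\<forall>\<^sub>F n in sequentially. norm (real (lower_threshold H n)) \<le>
        6 * C * norm (real n powr (1 / max_density H))"
      using eventually_ge_at_top[of 1] by eventually_elim (use bound in simp)
  qed
qed

end
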